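(* Suppose that $V_x$ and $V_t$ are finite dimensional, and let $b_s$ be a symmetric coercive continuous bilinear form on $V\times V$. Then there exists $\kappa>0$ such that the following holds. Let $b$ be any (not necessarily symmetric) continuous bilinear form on $V\times V$ such that $a:=b_s+b$ has the property that for every continuous linear form $g$ on $V$ there is a unique $w\in V$ with $a(w,v)=g(v)$ for all $v\in V$, and let $l$ be any continuous linear form on $V$. Let $u\in V$ be the unique solution of $a(u,v)=l(v)$ for all $v\in V$. If $$\|\mathcal{B}_s^{-1}\mathcal{B}\|_{\mathfrak{L}(V,V)}\le \kappa ,$$ then every sequence $(u_n)_{n\in\mathbb{N}^*}$ produced by the Decomposition algorithm (for the data $b_s,b,l$) converges strongly to $u$ in $V$.
   Context: Setting. Let $\mathcal{X}\subset\mathbb{R}^{m_x}$ and $\mathcal{T}\subset\mathbb{R}^{m_t}$ be open sets equipped with measures, and let $L^2(\mathcal{X})$, $L^2(\mathcal{T})$ and $L^2(\mathcal{X}\times\mathcal{T})=L^2(\mathcal{X})\otimes L^2(\mathcal{T})$ be the associated (real) $L^2$ spaces. Let $V_x\subset L^2(\mathcal{X})$, $V_t\subset L^2(\mathcal{T})$ and $V\subset L^2(\mathcal{X}\times\mathcal{T})$ be real Hilbert spaces with scalar products $\langle\cdot,\cdot\rangle_{V_x}$, $\langle\cdot,\cdot\rangle_{V_t}$, $\langle\cdot,\cdot\rangle_V$ and associated norms. For $(r,s)\in V_x\times V_t$, $r\otimes s$ denotes the function $(x,t)\mapsto r(x)s(t)$. Let $\Sigma:=\{r\otimes s:\ r\in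 V_x,\ s\in V_t\}$. Standing assumptions. $\Sigma\subset V$ and: (A1) the closure of $\mathrm{Span}(\Sigma)$ in $V$ equals $V$; (A2) $\Sigma$ is weakly closed in $V$; (A3) for the continuous bilinear form $a$ on $V\times V$: for every continuous linear form $l$ on $V$ there is a unique $u\in V$ such that $a(u,v)=l(v)$ for all $v\in V$. Operators. $\mathcal{B}_s$ and $\mathcal{B}$ are the bounded linear operators on $V$ defined by $b_s(v,w)=\langle \mathcal{B}_s v,w\rangle_V$ and $b(v,w)=\langle\mathcal{B}v,w\rangle_V$ for all $v,w\in V$; $\mathcal{B}_s$ is invertible because $b_s$ is coercive. $\mathfrak{L}(V,V)$ is the space of bounded linear operators from $V$ to $V$ with the operator norm induced by $\|\cdot\|_V$. Decomposition algorithm. Set $u_0=0$. For each $n\ge 1$, choose $$(r_n,s_n)\in \mathop{\mathrm{argmin}}_{(r,s)\in V_x\times V_t}\ \frac12 b_s(u_{n-1}+r\otimes s,\,u_{n-1}+r\otimes s)-l(r\otimes s)+b(u_{n-1},r\otimes s),$$ and set $u_n=u_{n-1}+r_n\otimes s_n$. *)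

theory Defs
  imports "HOL-Analysis.Analysis"
begin

text \<open>
  A real Hilbert space contained in \<open>L\<^sup>2(M)\<close>, with its own scalar product, is a complete real
  inner product space \<open>'v\<close> together with an injective linear map into \<open>L\<^sup>2(M)\<close>.  As there is no type of
  classes modulo almost everywhere equality, \<open>\<iota> v\<close> is a representative of the class of \<open>v\<close>, and linearity and
  injectivity are stated almost everywhere.  No relation between the two norms is assumed.
\<close>

definition L2_subspace :: "'a measure \<Rightarrow> ('v::{real_inner, complete_space} \<Rightarrow> 'a \<Rightarrow> real) \<Rightarrow> bool" where
  "L2_subspace M \<iota> \<longleftrightarrow>
     (\<forall>v. \<iota> v \<in> borel_measurable M \<and> integrable M (\<lambda>x. (\<iota> v x)\<^sup>2)) \<and>
     (\<forall>v w. AE x in M. \<iota> (v + w) x = \<iota> v x + \<iota> w x) \<and>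
     (\<forall>c v. AE x in M. \<iota> (c *\<^sub>R v) x = c * \<iota> v x) \<and>
     (\<forall>v. (AE x in M. \<iota> v x = 0) \<longrightarrow> v = 0)"

definition represents_tensor ::
  "'x measure \<Rightarrow> 't measure \<Rightarrow> ('r \<Rightarrow> 'x \<Rightarrow> real) \<Rightarrow> ('s \<Rightarrow> 't \<Rightarrow> real) \<Rightarrow> ('v \<Rightarrow> 'x \<times> 't \<Rightarrow> real)
    \<Rightarrow> 'r \<Rightarrow> 's \<Rightarrow> 'v \<Rightarrow> bool" where
  "represents_tensor \<mu>x \<mu>t \<iota>x \<iota>t \<iota> r s v \<longleftrightarrow>
     (AE p in \<mu>x \<Otimes>\<^sub>M \<mu>t. \<iota> v p = \<iota>x r (fst p) * \<iota>t s (snd p))"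

text \<open>The unique element of \<open>V\<close> that is the class of \<open>r \<otimes> s\<close>; it exists when \<open>\<Sigma> \<subseteq> V\<close>.\<close>

definition tensor ::
  "'x measure \<Rightarrow> 't measure \<Rightarrow> ('r \<Rightarrow> 'x \<Rightarrow> real) \<Rightarrow> ('s \<Rightarrow> 't \<Rightarrow> real) \<Rightarrow> ('v \<Rightarrow> 'x \<times> 't \<Rightarrow> real)
    \<Rightarrow> 'r \<Rightarrow> 's \<Rightarrow> 'v" where
  "tensor \<mu>x \<mu>t \<iota>x \<iota>t \<iota> r s = (THE v. represents_tensor \<mu>x \<mu>t \<iota>x \<iota>t \<iota> r s v)"

text \<open>
  The coarsest topology making all continuous linear forms continuous, obtained (like the strong
  operator topology in the library) as a pullback of the product topology.
\<close>

definition weak_topology :: "'v::real_normed_vector topology" where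
  "weak_topology = pullback_topology UNIV (\<lambda>v (f :: 'v \<Rightarrow>\<^sub>L real). blinfun_apply f v) euclidean"

definition symmetric_form :: "('v \<Rightarrow> 'v \<Rightarrow> real) \<Rightarrow> bool" where
  "symmetric_form b \<longleftrightarrow> (\<forall>v w. b v w = b w v)"

definition coercive_form :: "('v::real_normed_vector \<Rightarrow> 'v \<Rightarrow> real) \<Rightarrow> bool" where
  "coercive_form b \<longleftrightarrow> (\<exists>\<alpha>>0. \<forall>v. b v v \<ge> \<alpha> * (norm v)\<^sup>2)"

text \<open>The operator given by the Riesz representation theorem for a continuous bilinear form.\<close>

definition form_operator :: "('v::{real_inner, complete_space} \<Rightarrow> 'v \<Rightarrow> real) \<Rightarrow> 'v \<Rightarrow> 'v" where
  "form_operator b = (THE B. bounded_linear B \<and> (\<forall>v w. b v w = inner (B v) w))"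

definition uniquely_solvable :: "('v::real_normed_vector \<Rightarrow> 'v \<Rightarrow> real) \<Rightarrow> bool" where
  "uniquely_solvable a \<longleftrightarrow> (\<forall>g. bounded_linear g \<longrightarrow> (\<exists>!w. \<forall>v. a w v = g v))"

text \<open>
  \<open>u\<close> is a sequence produced by the decomposition algorithm, for any choice of the minimizers;
  \<open>T r s\<close> stands for \<open>r \<otimes> s\<close>.
\<close>

definition decomposition_sequence ::
  "('r \<Rightarrow> 's \<Rightarrow> 'v::real_vector) \<Rightarrow> ('v \<Rightarrow> 'v \<Rightarrow> real) \<Rightarrow> ('v \<Rightarrow> 'v \<Rightarrow> real) \<Rightarrow> ('v \<Rightarrow> real)
    \<Rightarrow> (nat \<Rightarrow> 'v) \<Rightarrow> bool" where
  "decomposition_sequence T bs b l u \<longleftrightarrow>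
     u 0 = 0 \<and>
     (\<exists>r s. \<forall>n\<ge>1.
        is_arg_min
          (\<lambda>(r', s'). 1/2 * bs (u (n - 1) + T r' s') (u (n - 1) + T r' s')
                      - l (T r' s') + b (u (n - 1)) (T r' s'))
          (\<lambda>_. True) (r n, s n) \<and>
        u n = u (n - 1) + T (r n) (s n))"

end

theory Submission
  imports Defs
begin

text \<open>
  Write \<open>K = B\<^sub>s\<inverse> B\<close>, \<open>e = u - u\<^sub>n\<^sub>-\<^sub>1\<close> and \<open>N v = sqrt (bs v v)\<close>.  Since \<open>bs u v + b u v = l v\<close>, the functional
  minimized in the algorithm equals, up to a constant, \<open>bs z z / 2 - bs (e + K e) z\<close> at \<open>z = r \<otimes> s\<close>.  A
  minimizer \<open>z\<close> is thus a best approximation of \<open>e + K e\<close> in \<open>\<Sigma>\<close> for the energy norm \<open>N\<close>.  As \<open>\<Sigma>\<close> is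
  a cone, comparing \<open>z\<close> with the points of its own line and of other lines of the cone gives
  \<open>bs (e + K e) z = (N z)\<^sup>2\<close> and \<open>\<bar>bs (e + K e) \<sigma>\<bar> \<le> N z * N \<sigma>\<close> for all \<open>\<sigma> \<in> \<Sigma>\<close>
  (lemma \<open>cone_minimizer\<close>).  The new error is \<open>e - z\<close>, and the first identity yields
  \<open>(N (e - z))\<^sup>2 = (N e)\<^sup>2 - (N z)\<^sup>2 + 2 * bs (K e) z\<close>.

  The finite dimension enters through a lower bound on the step \<open>N z\<close>.  Because \<open>V\<^sub>x\<close> and \<open>V\<^sub>t\<close> are finite
  dimensional, \<open>Span \<Sigma>\<close> is finite dimensional, hence closed, hence all of \<open>V\<close>.  A linear form on \<open>V\<close> is
  then controlled by its values on \<open>\<Sigma>\<close>: there is \<open>c \<in> (0, 1]\<close>, depending only on \<open>bs\<close> and \<open>\<Sigma>\<close>, such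
  that \<open>\<bar>f \<sigma>\<bar> \<le> d * N \<sigma>\<close> on \<open>\<Sigma>\<close> implies \<open>c * \<bar>f v\<bar> \<le> d * N v\<close> on \<open>V\<close>
  (lemma \<open>dual_bound_on_spanning_set\<close>).  Applied to \<open>f = bs (e + K e)\<close> and \<open>v = e\<close>, this gives
  \<open>N z \<ge> c * (1 - k) * N e\<close> as soon as \<open>N (K e) \<le> k * N e\<close>.  For \<open>k = c / 6\<close> the gain \<open>(N z)\<^sup>2\<close> beats the
  perturbation \<open>2 * bs (K e) z \<le> 2 * k * N e * N z\<close> and
  \<open>(N (e - z))\<^sup>2 \<le> (1 - c\<^sup>2 / 4) * (N e)\<^sup>2\<close> (lemma \<open>greedy_step_contraction\<close>), so the error decays
  geometrically.  The constant \<open>\<kappa>\<close> is \<open>c / 6\<close> corrected by the ratio of the constants that compare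
  \<open>N\<close> with the norm of \<open>V\<close>, because the hypothesis on \<open>K\<close> is in the operator norm of \<open>V\<close>.
\<close>

section \<open>Bilinearity of the tensor product\<close>

text \<open>
  The factors are arbitrary measures, not necessarily \<open>\<sigma>\<close>-finite, so the product formula on rectangles
  is not available in general.  For null rectangles it survives: either the iterated integral that
  defines the product measure is countably additive, and it vanishes on the rectangle, or the product
  measure is zero by convention.
\<close>

lemma emeasure_pair_measure_rectangle_null:
  assumes "A \<in> sets M" "B \<in> sets N" "emeasure M A = 0 \<or> emeasure N B = 0"
  shows "A \<times> B \<in> null_sets (M \<Otimes>\<^sub>M N)"
proof -
  have AB: "A \<times> B \<in> sets (M \<Otimes>\<^sub>M N)"
    using assms by auto
  have "(\<integral>\<^sup>+x. \<integral>\<^sup>+y. indicator (A \<times> B) (x, y) \<partial>N \<partial>M) =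
      (\<integral>\<^sup>+x. emeasure N B * indicator A x \<partial>M)"
    using assms(2) by (intro nn_integral_cong) (auto simp: indicator_times nn_integral_cmult mult.commute)
  also have "\<dots> = emeasure N B * emeasure M A"
    using assms(1) by (simp add: nn_integral_cmult_indicator)
  also have "\<dots> = 0"
    using assms(3) by auto
  finally have "(\<integral>\<^sup>+x. \<integral>\<^sup>+y. indicator (A \<times> B) (x, y) \<partial>N \<partial>M) = 0" .
  then have "emeasure (M \<Otimes>\<^sub>M N) (A \<times> B) = 0"
    unfolding pair_measure_def emeasure_measure_of_conv by auto
  with AB show ?thesis by (simp add: null_setsI)
qed

lemma AE_pair_measure_fst:
  assumes "AE x in M. P x"
  shows "AE p in M \<Otimes>\<^sub>M N. P (fst p)"
proof -
  obtain A where A: "{x \<in> space M. \<not> P x} \<subseteq> A" "A \<in> sets M" "emeasure M A = 0"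
    using assms by (auto elim: AE_E)
  then have "A \<times> space N \<in> null_sets (M \<Otimes>\<^sub>M N)"
    by (intro emeasure_pair_measure_rectangle_null) auto
  then show ?thesis
    by (rule AE_I') (use A(1) in \<open>auto simp: space_pair_measure\<close>)
qed

lemma AE_pair_measure_snd:
  assumes "AE y in N. P y"
  shows "AE p in M \<Otimes>\<^sub>M N. P (snd p)"
proof -
  obtain A where A: "{y \<in> space N. \<not> P y} \<subseteq> A" "A \<in> sets N" "emeasure N A = 0"
    using assms by (auto elim: AE_E)
  then have "space M \<times> A \<in> null_sets (M \<Otimes>\<^sub>M N)"
    by (intro emeasure_pair_measure_rectangle_null) auto
  then show ?thesis
    by (rule AE_I') (use A(1) in \<open>auto simp: space_pair_measure\<close>)
qed

lemma L2_subspace_AE_eq_imp_eq: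
  assumes "L2_subspace M \<iota>" "AE x in M. \<iota> v x = \<iota> w x"
  shows "v = w"
proof -
  have "AE x in M. \<iota> (v + (-1) *\<^sub>R w) x = \<iota> v x + \<iota> ((-1) *\<^sub>R w) x"
       "AE x in M. \<iota> ((-1) *\<^sub>R w) x = (-1) * \<iota> w x"
    using assms(1) unfolding L2_subspace_def by blast+
  with assms(2) have "AE x in M. \<iota> (v + (-1) *\<^sub>R w) x = 0"
    by eventually_elim simp
  then have "v + (-1) *\<^sub>R w = 0"
    using assms(1) unfolding L2_subspace_def by blast
  then show ?thesis by simp
qed

lemma tensor_eqI:
  assumes "L2_subspace (\<mu>x \<Otimes>\<^sub>M \<mu>t) \<iota>" "represents_tensor \<mu>x \<mu>t \<iota>x \<iota>t \<iota> r s v"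
  shows "tensor \<mu>x \<mu>t \<iota>x \<iota>t \<iota> r s = v"
  unfolding tensor_def
proof (rule the_equality)
  fix w assume "represents_tensor \<mu>x \<mu>t \<iota>x \<iota>t \<iota> r s w"
  then have "AE p in \<mu>x \<Otimes>\<^sub>M \<mu>t. \<iota> w p = \<iota> v p"
    using assms(2) unfolding represents_tensor_def by eventually_elim simp
  then show "w = v"
    by (rule L2_subspace_AE_eq_imp_eq[OF assms(1)])
qed (rule assms(2))

text \<open>
  Linearity of the three embeddings holds only almost everywhere.  Exceptional null sets of a factor
  become null sets of the product, so \<open>T r s + T r s'\<close> represents \<open>r \<otimes> (s + s')\<close>, and uniqueness of
  the represented class turns this into an equation in \<open>V\<close>.
\<close>

lemma bilinear_tensor:
  fixes \<iota>x :: "'r::{real_inner, complete_space} \<Rightarrow> 'x \<Rightarrow> real"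
    and \<iota>t :: "'s::{real_inner, complete_space} \<Rightarrow> 't \<Rightarrow> real"
    and \<iota> :: "'v::{real_inner, complete_space} \<Rightarrow> 'x \<times> 't \<Rightarrow> real"
  assumes x: "L2_subspace \<mu>x \<iota>x" and t: "L2_subspace \<mu>t \<iota>t"
    and v: "L2_subspace (\<mu>x \<Otimes>\<^sub>M \<mu>t) \<iota>"
    and ex: "\<forall>r s. \<exists>v. represents_tensor \<mu>x \<mu>t \<iota>x \<iota>t \<iota> r s v"
  shows "bilinear (tensor \<mu>x \<mu>t \<iota>x \<iota>t \<iota>)"
proof -
  let ?T = "tensor \<mu>x \<mu>t \<iota>x \<iota>t \<iota>"
  have T: "AE p in \<mu>x \<Otimes>\<^sub>M \<mu>t. \<iota> (?T r s) p = \<iota>x r (fst p) * \<iota>t s (snd p)" for r s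
  proof -
    obtain w where w: "represents_tensor \<mu>x \<mu>t \<iota>x \<iota>t \<iota> r s w" using ex by blast
    then show ?thesis unfolding tensor_eqI[OF v w] represents_tensor_def .
  qed
  have add: "AE p in \<mu>x \<Otimes>\<^sub>M \<mu>t. \<iota> (w + w') p = \<iota> w p + \<iota> w' p"
    and scale: "AE p in \<mu>x \<Otimes>\<^sub>M \<mu>t. \<iota> (c *\<^sub>R w) p = c * \<iota> w p" for w w' c
    using v unfolding L2_subspace_def by blast+
  have addx: "AE p in \<mu>x \<Otimes>\<^sub>M \<mu>t. \<iota>x (r + r') (fst p) = \<iota>x r (fst p) + \<iota>x r' (fst p)"
    and scalex: "AE p in \<mu>x \<Otimes>\<^sub>M \<mu>t. \<iota>x (c *\<^sub>R r) (fst p) = c * \<iota>x r (fst p)" for r r' c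
    by (rule AE_pair_measure_fst, use x in \<open>unfold L2_subspace_def, blast\<close>)+
  have addt: "AE p in \<mu>x \<Otimes>\<^sub>M \<mu>t. \<iota>t (s + s') (snd p) = \<iota>t s (snd p) + \<iota>t s' (snd p)"
    and scalet: "AE p in \<mu>x \<Otimes>\<^sub>M \<mu>t. \<iota>t (c *\<^sub>R s) (snd p) = c * \<iota>t s (snd p)" for s s' c
    by (rule AE_pair_measure_snd, use t in \<open>unfold L2_subspace_def, blast\<close>)+
  show ?thesis
    unfolding bilinear_def
  proof (intro conjI allI linearI)
    fix r s s' show "?T r (s + s') = ?T r s + ?T r s'"
      by (rule tensor_eqI[OF v], unfold represents_tensor_def,
          use add[of "?T r s" "?T r s'"] T[of r s] T[of r s'] addt[of s s'] in eventually_elim)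
        (simp add: algebra_simps)
  next
    fix r s c show "?T r (c *\<^sub>R s) = c *\<^sub>R ?T r s"
      by (rule tensor_eqI[OF v], unfold represents_tensor_def,
          use scale[of c "?T r s"] T[of r s] scalet[of c s] in eventually_elim) simp
  next
    fix r r' s show "?T (r + r') s = ?T r s + ?T r' s"
      by (rule tensor_eqI[OF v], unfold represents_tensor_def,
          use add[of "?T r s" "?T r' s"] T[of r s] T[of r' s] addx[of r r'] in eventually_elim)
        (simp add: algebra_simps)
  next
    fix r s c show "?T (c *\<^sub>R r) s = c *\<^sub>R ?T r s"
      by (rule tensor_eqI[OF v], unfold represents_tensor_def,
          use scale[of c "?T r s"] T[of r s] scalex[of c r] in eventually_elim) simp
  qed
qed

section \<open>Finite-dimensional inner product spaces\<close>

lemma bilinear_in_span_image: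
  assumes h: "bilinear h" and "span B = UNIV" "span C = UNIV"
  shows "h x y \<in> span {h b c | b c. b \<in> B \<and> c \<in> C}"
proof -
  let ?S = "{h b c | b c. b \<in> B \<and> c \<in> C}"
  have lin: "linear (h x)" "linear (\<lambda>x. h x y)" for x y
    using h by (auto simp: bilinear_def)
  have step: "h b y \<in> span ?S" if "b \<in> B" for b
  proof -
    have "h b y \<in> h b ` span C" using assms(3) by auto
    also have "\<dots> = span (h b ` C)"
      by (rule linear_span_image[OF lin(1), symmetric])
    also have "\<dots> \<subseteq> span ?S"
      by (rule span_mono) (use that in auto)
    finally show ?thesis .
  qed
  have "h x y \<in> (\<lambda>x. h x y) ` span B" using assms(2) by auto
  also have "\<dots> = span ((\<lambda>x. h x y) ` B)"
    by (rule linear_span_image[OF lin(2), symmetric])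
  also have "\<dots> \<subseteq> span ?S"
    by (rule span_minimal) (use step in auto)
  finally show ?thesis .
qed

text \<open>
  The space \<open>V\<close> is not of class \<open>euclidean_space\<close>; an explicit finite orthonormal set plays the role of
  its canonical basis, through the expansion \<open>v = (\<Sum>c\<in>C. (v \<bullet> c) *\<^sub>R c)\<close>.
\<close>

lemma orthonormal_expansion_in_span:
  fixes B :: "'v::real_inner set"
  assumes "finite B"
  obtains C where "finite C" "C \<subseteq> span B" "\<forall>c\<in>C. norm c = 1"
    "\<And>v. v \<in> span B \<Longrightarrow> (\<Sum>c\<in>C. (v \<bullet> c) *\<^sub>R c) = v"
proof -
  obtain D where D: "finite D" "span D = span B" "pairwise orthogonal D"
    using basis_orthogonal[OF \<open>finite B\<close>] by blast
  define C where "C = sgn ` (D - {0})"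
  have fin: "finite C" and norm1: "\<forall>c\<in>C. norm c = 1"
    using D(1) by (auto simp: C_def norm_sgn split: if_splits)
  have ortho: "d \<bullet> c = 0" if "c \<in> C" "d \<in> C" "c \<noteq> d" for c d
  proof -
    obtain c' d' where "c' \<in> D" "d' \<in> D" "c = sgn c'" "d = sgn d'"
      using \<open>c \<in> C\<close> \<open>d \<in> C\<close> by (auto simp: C_def)
    moreover have "c' \<noteq> d'" using calculation \<open>c \<noteq> d\<close> by auto
    ultimately have "d' \<bullet> c' = 0"
      using D(3) by (auto simp: pairwise_def orthogonal_def inner_commute)
    then show ?thesis using \<open>c = sgn c'\<close> \<open>d = sgn d'\<close> by (simp add: sgn_div_norm)
  qed
  let ?p = "\<lambda>v. \<Sum>c\<in>C. (v \<bullet> c) *\<^sub>R c"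
  have pC: "?p d = d" if "d \<in> C" for d
  proof -
    have "?p d = (\<Sum>c\<in>C. if c = d then d else 0)"
      using that ortho norm1 by (intro sum.cong) (auto simp: dot_square_norm)
    then show ?thesis using fin that by simp
  qed
  have sub: "subspace {v. ?p v = v}"
    by (auto simp: subspace_def inner_add_left scaleR_add_left sum.distrib scaleR_sum_right[symmetric]
        simp flip: scaleR_scaleR)
  have "D \<subseteq> {v. ?p v = v}"
  proof
    fix d assume "d \<in> D"
    have "?p (norm d *\<^sub>R sgn d) = norm d *\<^sub>R sgn d" if "d \<noteq> 0"
    proof -
      have "sgn d \<in> {v. ?p v = v}" using pC \<open>d \<in> D\<close> that by (auto simp: C_def)
      then have "norm d *\<^sub>R sgn d \<in> {v. ?p v = v}" by (rule subspace_scale[OF sub])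
      then show ?thesis by blast
    qed
    then show "d \<in> {v. ?p v = v}" by (cases "d = 0") (auto simp: sgn_div_norm)
  qed
  then have "span B \<subseteq> {v. ?p v = v}"
    using span_minimal[OF _ sub] D(2) by blast
  moreover have "C \<subseteq> span B"
    unfolding D(2)[symmetric] by (auto simp: C_def sgn_div_norm intro: span_scale span_base)
  ultimately show ?thesis using that fin norm1 by blast
qed

text \<open>The span is the set of fixed points of the continuous orthogonal projection onto it.\<close>

lemma closed_span_finite:
  fixes B :: "'v::real_inner set"
  assumes "finite B"
  shows "closed (span B)"
proof -
  obtain C where C: "C \<subseteq> span B" "\<And>v. v \<in> span B \<Longrightarrow> (\<Sum>c\<in>C. (v \<bullet> c) *\<^sub>R c) = v"
    using orthonormal_expansion_in_span[OF assms] by metis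
  have "v \<in> span B" if "(\<Sum>c\<in>C. (v \<bullet> c) *\<^sub>R c) = v" for v
    by (subst that[symmetric]) (use C(1) in \<open>auto intro!: span_sum span_scale\<close>)
  with C(2) have "span B = {v. (\<Sum>c\<in>C. (v \<bullet> c) *\<^sub>R c) = v}" by blast
  moreover have "closed {v. (\<Sum>c\<in>C. (v \<bullet> c) *\<^sub>R c) = v}"
    by (intro closed_Collect_eq continuous_intros)
  ultimately show ?thesis by simp
qed

text \<open>
  The image of a basis is independent; a vector outside its span would give an independent set with one
  element more than the basis.
\<close>

lemma injective_endomorphism_surj:
  fixes f :: "'v::real_vector \<Rightarrow> 'v" and C :: "'v set"
  assumes "finite C" "span C = UNIV" "linear f" "inj f"
  shows "surj f"
proof -
  obtain B where B: "B \<subseteq> C" "independent B" "C \<subseteq> span B"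
    using maximal_independent_subset by blast
  have "span B = UNIV" using assms(2) B(3) by (metis span_mono span_span top.extremum_uniqueI)
  have finB: "finite B" using B(1) assms(1) finite_subset by blast
  have ind: "independent (f ` B)"
    using assms(3) B(2) assms(4) by (meson linear_independent_injective_image inj_on_subset subset_UNIV)
  have card: "card (f ` B) = card B"
    by (rule card_image) (use assms(4) inj_on_subset in blast)
  have "y \<in> span (f ` B)" for y
  proof (rule ccontr)
    assume y: "y \<notin> span (f ` B)"
    then have "independent (insert y (f ` B))" using ind by (simp add: independent_insert)
    then have "card (insert y (f ` B)) \<le> card B"
      using independent_span_bound[OF finB] \<open>span B = UNIV\<close> by simp
    moreover have "y \<notin> f ` B" using y span_superset[of "f ` B"] by blast
    ultimately show False using finB card by simp
  qed
  then have "UNIV \<subseteq> f ` span B"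
    using linear_span_image[OF assms(3)] by blast
  then show ?thesis by auto
qed

text \<open>
  The constant depends on \<open>v\<close>, through some expression of \<open>v\<close> as a linear combination of elements of \<open>S\<close>,
  but not on the form \<open>f\<close> nor on its bound \<open>d\<close> on \<open>S\<close>.
\<close>

lemma span_dual_bound:
  fixes v :: "'v::real_normed_vector"
  assumes "v \<in> span S"
  shows "\<exists>L\<ge>0. \<forall>f d. linear f \<longrightarrow> (\<forall>\<sigma>\<in>S. \<bar>f \<sigma>\<bar> \<le> d * norm \<sigma>) \<longrightarrow> 0 \<le> d \<longrightarrow> \<bar>f v :: real\<bar> \<le> L * d"
  using assms
proof (induction rule: span_induct_alt)
  case base
  show ?case by (rule exI[of _ 0]) (auto simp: linear_0)
next
  case (step c x y)
  then obtain L where L: "L \<ge> 0" "\<And>f d. linear f \<Longrightarrow> \<forall>\<sigma>\<in>S. \<bar>f \<sigma>\<bar> \<le> d * norm \<sigma> \<Longrightarrow> 0 \<le> d \<Longrightarrow> \<bar>f y :: real\<bar> \<le> L * d"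
    by blast
  have "\<bar>f (c *\<^sub>R x + y)\<bar> \<le> (\<bar>c\<bar> * norm x + L) * d"
    if f: "linear f" "\<forall>\<sigma>\<in>S. \<bar>f \<sigma>\<bar> \<le> d * norm \<sigma>" "0 \<le> d" for f :: "'v \<Rightarrow> real" and d
  proof -
    have "\<bar>f (c *\<^sub>R x + y)\<bar> \<le> \<bar>c\<bar> * \<bar>f x\<bar> + \<bar>f y\<bar>"
      using f(1) by (simp add: linear_add linear_scale abs_triangle_ineq flip: abs_mult)
    also have "\<dots> \<le> \<bar>c\<bar> * (d * norm x) + L * d"
      using f L(2)[OF f] step.hyps by (intro add_mono mult_left_mono) auto
    finally show ?thesis by (simp add: algebra_simps)
  qed
  with L(1) show ?case by (intro exI[of _ "\<bar>c\<bar> * norm x + L"]) auto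
qed

text \<open>
  This is equivalence of the dual norm with the supremum over the normalized elements of \<open>S\<close>.  The
  pointwise constants for the finitely many \<open>c \<in> C\<close> add up, as
  \<open>f v = (\<Sum>c\<in>C. (v \<bullet> c) * f c)\<close>.
\<close>

lemma dual_bound_on_spanning_set:
  fixes S C :: "'v::real_inner set"
  assumes C: "finite C" "\<forall>c\<in>C. norm c = 1" "\<And>v. (\<Sum>c\<in>C. (v \<bullet> c) *\<^sub>R c) = v"
    and S: "span S = UNIV"
  obtains L where "L > 0"
    "\<And>f d v. linear f \<Longrightarrow> \<forall>\<sigma>\<in>S. \<bar>f \<sigma> :: real\<bar> \<le> d * norm \<sigma> \<Longrightarrow> 0 \<le> d \<Longrightarrow> \<bar>f v\<bar> \<le> L * d * norm v"
proof -
  have "\<forall>c. \<exists>L\<ge>0. \<forall>f d. linear f \<longrightarrow> (\<forall>\<sigma>\<in>S. \<bar>f \<sigma>\<bar> \<le> d * norm \<sigma>) \<longrightarrow> 0 \<le> d \<longrightarrow> \<bar>f c :: real\<bar> \<le> L * d"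
    using span_dual_bound[of _ S] S by blast
  then obtain L where L: "\<And>c. L c \<ge> 0"
    "\<And>c f d. linear f \<Longrightarrow> \<forall>\<sigma>\<in>S. \<bar>f \<sigma>\<bar> \<le> d * norm \<sigma> \<Longrightarrow> 0 \<le> d \<Longrightarrow> \<bar>f c :: real\<bar> \<le> L c * d"
    by metis
  show ?thesis
  proof (rule that[of "1 + sum L C"])
    show "0 < 1 + sum L C" using L(1) by (simp add: sum_nonneg add_pos_nonneg)
    fix f :: "'v \<Rightarrow> real" and d v
    assume f: "linear f" "\<forall>\<sigma>\<in>S. \<bar>f \<sigma>\<bar> \<le> d * norm \<sigma>" "0 \<le> d"
    have "f v = f (\<Sum>c\<in>C. (v \<bullet> c) *\<^sub>R c)" by (simp add: C(3))
    also have "\<dots> = (\<Sum>c\<in>C. (v \<bullet> c) * f c)"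
      by (simp add: linear_sum[OF f(1)] linear_scale[OF f(1)])
    also have "\<bar>\<dots>\<bar> \<le> (\<Sum>c\<in>C. \<bar>v \<bullet> c\<bar> * \<bar>f c\<bar>)"
      by (rule order_trans[OF sum_abs]) (simp add: abs_mult)
    also have "\<dots> \<le> (\<Sum>c\<in>C. norm v * (L c * d))"
      using f L Cauchy_Schwarz_ineq2[of v] C(2)
      by (intro sum_mono mult_mono) (auto, metis mult.right_neutral)
    also have "\<dots> = sum L C * d * norm v"
      by (simp add: sum_distrib_left sum_distrib_right mult_ac)
    also have "\<dots> \<le> (1 + sum L C) * d * norm v"
      using f(3) by (intro mult_right_mono) auto
    finally show "\<bar>f v\<bar> \<le> (1 + sum L C) * d * norm v" .
  qed
qed

text \<open>
  The Riesz representative of \<open>b v\<close> is explicit in an orthonormal basis: it is \<open>(\<Sum>c\<in>C. b v c *\<^sub>R c)\<close>.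
\<close>

lemma form_operator_properties:
  fixes b :: "'v::{real_inner, complete_space} \<Rightarrow> 'v \<Rightarrow> real" and C :: "'v set"
  assumes C: "\<And>v. (\<Sum>c\<in>C. (v \<bullet> c) *\<^sub>R c) = v"
    and b: "bounded_bilinear b"
  shows "bounded_linear (form_operator b)" "b v w = form_operator b v \<bullet> w"
proof -
  interpret b: bounded_bilinear b by (rule b)
  define F where "F v = (\<Sum>c\<in>C. b v c *\<^sub>R c)" for v
  have lin: "bounded_linear F"
    unfolding F_def
    by (intro bounded_linear_sum bounded_linear_scaleR_left[THEN bounded_linear_compose] b.bounded_linear_left)
  have rep: "b v w = F v \<bullet> w" for v w
  proof -
    have "b v w = b v (\<Sum>c\<in>C. (w \<bullet> c) *\<^sub>R c)" by (simp add: C)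
    also have "\<dots> = F v \<bullet> w"
      by (simp add: F_def b.sum_right b.scaleR_right inner_sum_left inner_commute[of w] mult.commute)
    finally show ?thesis .
  qed
  have "form_operator b = F"
    unfolding form_operator_def
  proof (rule the_equality)
    show "bounded_linear F \<and> (\<forall>v w. b v w = F v \<bullet> w)" using lin rep by blast
    fix G assume "bounded_linear G \<and> (\<forall>v w. b v w = G v \<bullet> w)"
    then have "G v \<bullet> w = F v \<bullet> w" for v w using rep by metis
    then show "G = F" by (metis ext vector_eq_rdot)
  qed
  with lin rep show "bounded_linear (form_operator b)" "b v w = form_operator b v \<bullet> w" by auto
qed

text \<open>
  Coercivity gives \<open>\<alpha> * norm v \<le> norm (B\<^sub>s v)\<close>, which makes \<open>B\<^sub>s\<close> injective, hence bijective in finite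
  dimension, with inverse bounded by \<open>1 / \<alpha>\<close>.  Boundedness of \<open>K\<close> is what makes its \<open>onorm\<close> a genuine
  bound.
\<close>

lemma relative_form_operator:
  fixes bs b :: "'v::{real_inner, complete_space} \<Rightarrow> 'v \<Rightarrow> real" and C :: "'v set"
  assumes C: "finite C" "\<And>v. (\<Sum>c\<in>C. (v \<bullet> c) *\<^sub>R c) = v"
    and bs: "bounded_bilinear bs" "coercive_form bs"
    and b: "bounded_bilinear b"
  defines "K \<equiv> inv (form_operator bs) \<circ> form_operator b"
  shows "bounded_linear K" "bs (K v) w = b v w"
proof -
  let ?S = "form_operator bs" and ?B = "form_operator b"
  note S = form_operator_properties[OF C(2) bs(1)] and B = form_operator_properties[OF C(2) b]
  obtain \<alpha> where \<alpha>: "\<alpha> > 0" "\<And>v. bs v v \<ge> \<alpha> * (norm v)\<^sup>2"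
    using bs(2) unfolding coercive_form_def by blast
  have below: "\<alpha> * norm v \<le> norm (?S v)" for v
  proof (cases "v = 0")
    case False
    have "(\<alpha> * norm v) * norm v \<le> ?S v \<bullet> v"
      using \<alpha>(2)[of v] S(2)[of v v] by (simp add: power2_eq_square mult.assoc)
    also have "\<dots> \<le> norm (?S v) * norm v" by (rule norm_cauchy_schwarz)
    finally show ?thesis using False by simp
  qed simp
  have lin: "linear ?S" using S(1) by (simp add: bounded_linear.linear)
  have inj: "inj ?S"
    unfolding linear_injective_0[OF lin]
  proof (intro allI impI)
    fix v assume "?S v = 0"
    then show "v = 0" using below[of v] \<alpha>(1) by (simp add: mult_le_0_iff)
  qed
  have "v \<in> span C" for v
    by (subst C(2)[of v, symmetric]) (intro span_sum span_scale span_base)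
  then have "span C = UNIV" by blast
  then have surj: "surj ?S"
    by (rule injective_endomorphism_surj[OF C(1) _ lin inj])
  have "bounded_linear (inv ?S)"
  proof (rule bounded_linear_intro[of _ "1 / \<alpha>"])
    fix x y :: 'v and r :: real
    show "inv ?S (x + y) = inv ?S x + inv ?S y"
      by (rule inv_f_eq[OF inj]) (simp add: linear_add[OF lin] surj_f_inv_f[OF surj])
    show "inv ?S (r *\<^sub>R x) = r *\<^sub>R inv ?S x"
      by (rule inv_f_eq[OF inj]) (simp add: linear_scale[OF lin] surj_f_inv_f[OF surj])
    show "norm (inv ?S x) \<le> norm x * (1 / \<alpha>)"
      using below[of "inv ?S x"] \<alpha>(1) by (simp add: surj_f_inv_f[OF surj] field_simps)
  qed
  then show "bounded_linear K"
    unfolding K_def o_def using B(1) by (rule bounded_linear_compose)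
  show "bs (K v) w = b v w"
    by (simp add: K_def S(2) B(2) surj_f_inv_f[OF surj])
qed

section \<open>One greedy step\<close>

lemma nonneg_quadratic_discriminant:
  fixes A B C :: real
  assumes "A \<ge> 0" "\<And>t. 0 \<le> A * t\<^sup>2 + 2 * B * t + C"
  shows "B\<^sup>2 \<le> A * C"
proof (cases "A = 0")
  case True
  have "B = 0"
    using assms(2)[of "- (C + 1) / (2 * B)"] True by (cases "B = 0") auto
  then show ?thesis using True by simp
next
  case False
  have "0 \<le> A * (A * (- B / A)\<^sup>2 + 2 * B * (- B / A) + C)"
    by (rule mult_nonneg_nonneg[OF assms])
  also have "\<dots> = A * C - B\<^sup>2"
    using False by (simp add: power2_eq_square field_simps)
  finally show ?thesis by simp
qed

lemma symmetric_form_Cauchy_Schwarz: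
  assumes b: "bounded_bilinear b" "symmetric_form b" "\<And>v. 0 \<le> b v v"
  shows "(b x y)\<^sup>2 \<le> b x x * b y y"
proof -
  interpret bounded_bilinear b by (rule b)
  have "b (x + t *\<^sub>R y) (x + t *\<^sub>R y) = b y y * t\<^sup>2 + 2 * b x y * t + b x x" for t
    using b(2)[unfolded symmetric_form_def, rule_format, of y x]
    by (simp add: add_left add_right scaleR_left scaleR_right power2_eq_square algebra_simps)
  then have "(b x y)\<^sup>2 \<le> b y y * b x x"
    using b(3) by (intro nonneg_quadratic_discriminant) metis+
  then show ?thesis by (simp add: mult.commute)
qed

text \<open>
  On the line of \<open>z\<close> itself, minimality at parameter \<open>1\<close> is the Euler equation \<open>f z = b z z\<close>, and so the
  minimal value is \<open>- b z z / 2\<close>.  On the line of \<open>\<sigma>\<close>, the quadratic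
  \<open>t\<^sup>2 * b \<sigma> \<sigma> - 2 * t * f \<sigma> + b z z\<close> is therefore nonnegative, and its discriminant is not positive.
\<close>

lemma cone_minimizer:
  fixes b :: "'v::real_normed_vector \<Rightarrow> 'v \<Rightarrow> real"
  assumes b: "bounded_bilinear b" "\<And>v. 0 \<le> b v v" and f: "linear f"
    and cone: "\<And>t \<sigma>. \<sigma> \<in> S \<Longrightarrow> t *\<^sub>R \<sigma> \<in> S"
    and z: "z \<in> S" "\<And>\<sigma>. \<sigma> \<in> S \<Longrightarrow> 1/2 * b z z - f z \<le> 1/2 * b \<sigma> \<sigma> - f \<sigma>"
  shows "f z = b z z" "\<And>\<sigma>. \<sigma> \<in> S \<Longrightarrow> (f \<sigma>)\<^sup>2 \<le> b \<sigma> \<sigma> * b z z"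
proof -
  interpret bounded_bilinear b by (rule b)
  have ray: "1/2 * b z z - f z \<le> 1/2 * (t\<^sup>2 * b \<sigma> \<sigma>) - t * f \<sigma>" if "\<sigma> \<in> S" for t \<sigma>
    using z(2)[OF cone[OF that, of t]]
    by (simp add: scaleR_left scaleR_right linear_scale[OF f] power2_eq_square)
  have "((b z z - f z) / 2)\<^sup>2 \<le> b z z / 2 * 0"
  proof (rule nonneg_quadratic_discriminant)
    fix t show "0 \<le> b z z / 2 * t\<^sup>2 + 2 * ((b z z - f z) / 2) * t + 0"
      using ray[OF z(1), of "1 + t"] by (simp add: power2_eq_square field_simps)
  qed (simp add: b(2))
  then show eq: "f z = b z z" by simp
  fix \<sigma> assume "\<sigma> \<in> S"
  have "(- f \<sigma>)\<^sup>2 \<le> b \<sigma> \<sigma> * b z z"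
  proof (rule nonneg_quadratic_discriminant)
    fix t show "0 \<le> b \<sigma> \<sigma> * t\<^sup>2 + 2 * (- f \<sigma>) * t + b z z"
      using ray[OF \<open>\<sigma> \<in> S\<close>, of t] eq by (simp add: field_simps)
  qed (rule b(2))
  then show "(f \<sigma>)\<^sup>2 \<le> b \<sigma> \<sigma> * b z z" by simp
qed

text \<open>
  Here \<open>E\<close>, \<open>Z\<close> and \<open>k * E\<close> stand for the energy norms of the error and of the step, and for the bound
  on the energy norm of the perturbation of the error.  The choice \<open>k = c / 6\<close> leaves
  \<open>Z - 2 * k * E \<ge> (5/6 - 1/3) * c * E = c * E / 2\<close>.
\<close>

lemma perturbed_step_contraction:
  fixes E Z c k :: real
  assumes "0 \<le> E" "0 \<le> Z" "0 < c" "c \<le> 1" "k = c / 6" "c * (1 - k) * E \<le> Z"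
  shows "E\<^sup>2 - Z\<^sup>2 + 2 * k * E * Z \<le> (1 - c\<^sup>2 / 4) * E\<^sup>2"
proof -
  have "k \<le> 1 / 6" using assms by simp
  then have "c * E * (5 / 6) \<le> c * E * (1 - k)"
    using assms by (intro mult_left_mono) auto
  moreover have "c * E * (1 - k) \<le> Z"
    using assms(6) by (simp only: mult_ac)
  ultimately have Z: "5 / 6 * (c * E) \<le> Z" by linarith
  have cE: "0 \<le> c * E" using assms by simp
  have "2 * k * E = c * E / 3" using assms(5) by simp
  then have "c * E / 2 \<le> Z" "c * E / 2 \<le> Z - 2 * k * E"
    using Z cE by linarith+
  then have "(c * E / 2) * (c * E / 2) \<le> Z * (Z - 2 * k * E)"
    using cE by (intro mult_mono) auto
  then show ?thesis by (simp add: power2_eq_square algebra_simps)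
qed

text \<open>
  The hypothesis on \<open>c\<close> says that linear forms are controlled by their values on \<open>S\<close>.  The step \<open>z\<close> is
  chosen for \<open>e + w\<close> in place of the true error \<open>e\<close>; testing the form \<open>bs (e + w)\<close> at \<open>e\<close> shows that
  \<open>z\<close> cannot be small compared with \<open>e\<close>.
\<close>

lemma greedy_step_contraction:
  fixes bs :: "'v::real_normed_vector \<Rightarrow> 'v \<Rightarrow> real"
  assumes bs: "bounded_bilinear bs" "symmetric_form bs" "\<And>v. 0 \<le> bs v v"
    and c: "0 < c" "c \<le> 1"
    and dual: "\<And>f d v. linear f \<Longrightarrow> 0 \<le> d \<Longrightarrow> (\<And>\<sigma>. \<sigma> \<in> S \<Longrightarrow> \<bar>f \<sigma>\<bar> \<le> d * sqrt (bs \<sigma> \<sigma>))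
      \<Longrightarrow> c * \<bar>f v\<bar> \<le> d * sqrt (bs v v)"
    and cone: "\<And>t \<sigma>. \<sigma> \<in> S \<Longrightarrow> t *\<^sub>R \<sigma> \<in> S"
    and w: "sqrt (bs w w) \<le> c / 6 * sqrt (bs e e)"
    and z: "z \<in> S"
      "\<And>\<sigma>. \<sigma> \<in> S \<Longrightarrow> 1/2 * bs z z - bs (e + w) z \<le> 1/2 * bs \<sigma> \<sigma> - bs (e + w) \<sigma>"
  shows "bs (e - z) (e - z) \<le> (1 - c\<^sup>2 / 4) * bs e e"
proof -
  interpret bounded_bilinear bs by (rule bs(1))
  let ?N = "\<lambda>v. sqrt (bs v v)"
  have CS: "\<bar>bs x y\<bar> \<le> ?N x * ?N y" for x y
    using real_sqrt_le_mono[OF symmetric_form_Cauchy_Schwarz[OF bs, of x y]]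
    by (simp add: real_sqrt_mult)
  have lin: "linear (bs (e + w))"
    by (rule bounded_linear.linear[OF bounded_linear_right])
  have min: "bs (e + w) z = bs z z" "\<And>\<sigma>. \<sigma> \<in> S \<Longrightarrow> (bs (e + w) \<sigma>)\<^sup>2 \<le> bs \<sigma> \<sigma> * bs z z"
    using cone_minimizer[of bs "bs (e + w)" S z] bs(1,3) lin cone z by blast+
  have N0: "0 \<le> ?N v" and Nsq: "(?N v)\<^sup>2 = bs v v" for v
    using bs(3) by auto
  have "\<bar>bs (e + w) \<sigma>\<bar> \<le> ?N z * ?N \<sigma>" if "\<sigma> \<in> S" for \<sigma>
    using real_sqrt_le_mono[OF min(2)[OF that]] by (simp add: real_sqrt_mult mult.commute)
  then have "c * \<bar>bs (e + w) e\<bar> \<le> ?N z * ?N e"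
    by (intro dual lin N0)
  moreover have "(1 - c / 6) * ?N e * ?N e \<le> \<bar>bs (e + w) e\<bar>"
  proof -
    have "\<bar>bs w e\<bar> \<le> c / 6 * ?N e * ?N e"
      using CS[of w e] mult_right_mono[OF w N0[of e]] by linarith
    then show ?thesis
      using Nsq[of e] by (simp add: add_left power2_eq_square algebra_simps)
  qed
  then have "c * ((1 - c / 6) * ?N e * ?N e) \<le> c * \<bar>bs (e + w) e\<bar>"
    using c(1) by (intro mult_left_mono) auto
  ultimately have "c * (1 - c / 6) * ?N e * ?N e \<le> ?N z * ?N e"
    by (simp only: mult.assoc)
  then have "c * (1 - c / 6) * ?N e \<le> ?N z"
    using N0[of e] N0[of z] by (cases "?N e = 0") (auto simp: mult_le_cancel_right)
  then have contr: "(?N e)\<^sup>2 - (?N z)\<^sup>2 + 2 * (c / 6) * ?N e * ?N z \<le> (1 - c\<^sup>2 / 4) * (?N e)\<^sup>2"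
    by (intro perturbed_step_contraction N0 c refl)
  have "bs (e - z) (e - z) = bs e e - bs z z + 2 * bs w z"
    using min(1) bs(2)[unfolded symmetric_form_def, rule_format, of z e]
    by (simp add: diff_left diff_right add_left)
  also have "\<dots> \<le> bs e e - bs z z + 2 * (c / 6 * ?N e * ?N z)"
    using CS[of w z] mult_right_mono[OF w N0[of z]] by linarith
  also have "\<dots> \<le> (1 - c\<^sup>2 / 4) * bs e e"
    using contr unfolding Nsq by (simp add: mult_ac)
  finally show ?thesis .
qed

lemma geometric_decay_imp_convergence:
  fixes U :: "nat \<Rightarrow> 'v::real_normed_vector"
  assumes "\<alpha> > 0" "\<And>v. \<alpha> * (norm v)\<^sup>2 \<le> q v" "0 \<le> \<rho>" "\<rho> < 1"
    and step: "\<And>n. q (u - U (Suc n)) \<le> \<rho> * q (u - U n)"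
  shows "U \<longlonglongrightarrow> u"
proof -
  have bound: "q (u - U n) \<le> \<rho> ^ n * q (u - U 0)" for n
  proof (induction n)
    case (Suc n)
    have "q (u - U (Suc n)) \<le> \<rho> * (\<rho> ^ n * q (u - U 0))"
      by (rule order_trans[OF step mult_left_mono[OF Suc assms(3)]])
    then show ?case by (simp add: mult_ac)
  qed simp
  have "(\<lambda>n. \<rho> ^ n * q (u - U 0) / \<alpha>) \<longlonglongrightarrow> 0 * q (u - U 0) / \<alpha>"
    using assms by (intro tendsto_intros LIMSEQ_realpow_zero) auto
  then have lim: "(\<lambda>n. \<rho> ^ n * q (u - U 0) / \<alpha>) \<longlonglongrightarrow> 0" by simp
  have "(norm (u - U n))\<^sup>2 \<le> \<rho> ^ n * q (u - U 0) / \<alpha>" for n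
    using order_trans[OF assms(2) bound] assms(1) by (simp add: field_simps)
  then have "(\<lambda>n. (norm (u - U n))\<^sup>2) \<longlonglongrightarrow> 0"
    by (intro tendsto_sandwich[OF _ _ tendsto_const lim]) auto
  then have "(\<lambda>n. sqrt ((norm (u - U n))\<^sup>2)) \<longlonglongrightarrow> sqrt 0"
    by (rule tendsto_real_sqrt)
  then have "(\<lambda>n. u - U n) \<longlonglongrightarrow> 0"
    by (simp add: tendsto_norm_zero_iff)
  then have "(\<lambda>n. u - (u - U n)) \<longlonglongrightarrow> u - 0"
    by (intro tendsto_intros)
  then show ?thesis by simp
qed
section \<open>Convergence\<close>

text \<open>
  Bilinearity of \<open>T\<close> makes its values a cone, and the span condition makes them control linear forms.
\<close>

lemma small_perturbation_greedy_convergence: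
  fixes bs :: "'v::{real_inner, complete_space} \<Rightarrow> 'v \<Rightarrow> real"
    and T :: "'r::real_vector \<Rightarrow> 's::real_vector \<Rightarrow> 'v" and B :: "'v set"
  assumes T: "bilinear T"
    and B: "finite B" "span B = UNIV"
    and spanT: "span {T r s | r s. True} = UNIV"
    and bs: "bounded_bilinear bs" "symmetric_form bs" "coercive_form bs"
  shows "\<exists>\<kappa>>0. \<forall>b l u.
           bounded_bilinear b \<longrightarrow>
           (\<forall>v. bs u v + b u v = l v) \<longrightarrow>
           onorm (inv (form_operator bs) \<circ> form_operator b) \<le> \<kappa> \<longrightarrow>
           (\<forall>U. decomposition_sequence T bs b l U \<longrightarrow> U \<longlonglongrightarrow> u)"
proof -
  interpret bs: bounded_bilinear bs by (rule bs(1))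
  let ?S = "{T r s | r s. True}" and ?N = "\<lambda>v. sqrt (bs v v)"
  obtain C where C: "finite C" "C \<subseteq> span B" "\<forall>c\<in>C. norm c = 1"
      "\<And>v. v \<in> span B \<Longrightarrow> (\<Sum>c\<in>C. (v \<bullet> c) *\<^sub>R c) = v"
    by (rule orthonormal_expansion_in_span[OF B(1)], rule that)
  have expand: "(\<Sum>c\<in>C. (v \<bullet> c) *\<^sub>R c) = v" for v
    by (rule C(4)) (simp add: B(2))
  obtain L where L: "L > 0"
    "\<And>f d v. linear f \<Longrightarrow> \<forall>\<sigma>\<in>?S. \<bar>f \<sigma>\<bar> \<le> d * norm \<sigma> \<Longrightarrow> 0 \<le> d \<Longrightarrow> \<bar>f v\<bar> \<le> L * d * norm v"
    by (rule dual_bound_on_spanning_set[OF C(1,3) expand spanT], rule that)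
  obtain \<alpha> where \<alpha>: "\<alpha> > 0" "\<And>v. bs v v \<ge> \<alpha> * (norm v)\<^sup>2"
    using bs(3) unfolding coercive_form_def by blast
  obtain M where M: "M > 0" "\<And>v w. norm (bs v w) \<le> norm v * norm w * M"
    using bs.pos_bounded by blast
  have pos: "0 \<le> bs v v" for v
    by (rule order_trans[OF _ \<alpha>(2)]) (use \<alpha>(1) in simp)
  have lower: "sqrt \<alpha> * norm v \<le> ?N v" for v
    using real_sqrt_le_mono[OF \<alpha>(2)[of v]] by (simp add: real_sqrt_mult)
  have upper: "?N v \<le> sqrt M * norm v" for v
  proof -
    have "bs v v \<le> M * (norm v)\<^sup>2" using M(2)[of v v] by (simp add: power2_eq_square mult_ac)
    from real_sqrt_le_mono[OF this] show ?thesis by (simp add: real_sqrt_mult)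
  qed
  \<comment> \<open>\<open>\<theta>\<close> is the price of passing from the energy norm to the norm of \<open>V\<close> and back.  It is paid in \<open>c\<close>
    because \<open>L\<close> refers to the norm of \<open>V\<close>, and in \<open>\<kappa>\<close> because the operator norm does.\<close>
  define \<theta> where "\<theta> = sqrt \<alpha> / sqrt M"
  define c where "c = min 1 (\<theta> / L)"
  define \<kappa> where "\<kappa> = c / 6 * \<theta>"
  have \<theta>: "\<theta> > 0" "sqrt M * \<theta> = sqrt \<alpha>" using \<alpha>(1) M(1) by (auto simp: \<theta>_def)
  have c: "0 < c" "c \<le> 1" "c * L \<le> \<theta>"
    using \<theta>(1) L(1) by (auto simp: c_def min_def field_simps)
  have dual: "c * \<bar>f v\<bar> \<le> d * ?N v"
    if f: "linear f" "0 \<le> d" "\<And>\<sigma>. \<sigma> \<in> ?S \<Longrightarrow> \<bar>f \<sigma>\<bar> \<le> d * ?N \<sigma>" for f d v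
  proof -
    have bound: "\<bar>f \<sigma>\<bar> \<le> d * sqrt M * norm \<sigma>" if "\<sigma> \<in> ?S" for \<sigma>
      using f(3)[OF that] mult_left_mono[OF upper f(2), of \<sigma>] by (simp add: mult.assoc)
    have "\<bar>f v\<bar> \<le> L * (d * sqrt M) * norm v"
      by (rule L(2)[OF f(1)]) (use bound f(2) M(1) in simp_all)
    then have "c * \<bar>f v\<bar> \<le> c * (L * (d * sqrt M) * norm v)"
      using c(1) by (intro mult_left_mono) auto
    also have "\<dots> = c * L * (d * sqrt M * norm v)" by (simp add: mult_ac)
    also have "\<dots> \<le> \<theta> * (d * sqrt M * norm v)"
      using f(2) M(1) by (intro mult_right_mono c(3)) auto
    also have "\<dots> = d * (sqrt M * \<theta> * norm v)" by (simp add: mult_ac)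
    also have "\<dots> \<le> d * ?N v" unfolding \<theta>(2) by (intro mult_left_mono lower f(2))
    finally show ?thesis .
  qed
  have cone: "t *\<^sub>R \<sigma> \<in> ?S" if \<sigma>: "\<sigma> \<in> ?S" for t \<sigma>
  proof -
    obtain r s where "\<sigma> = T r s" using \<sigma> by blast
    then have "t *\<^sub>R \<sigma> = T (t *\<^sub>R r) s" by (simp add: bilinear_lmul[OF T])
    then show ?thesis by blast
  qed
  have "\<kappa> > 0" using c \<theta> by (simp add: \<kappa>_def)
  moreover have "U \<longlonglongrightarrow> u"
    if b: "bounded_bilinear b" and u: "\<forall>v. bs u v + b u v = l v"
      and small: "onorm (inv (form_operator bs) \<circ> form_operator b) \<le> \<kappa>"
      and U: "decomposition_sequence T bs b l U" for b l u U
  proof -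
    interpret b: bounded_bilinear b by (rule b)
    define K where "K = inv (form_operator bs) \<circ> form_operator b"
    note K = relative_form_operator[OF C(1) expand bs(1,3) b, folded K_def]
    have K_small: "?N (K v) \<le> c / 6 * ?N v" for v
    proof -
      have "norm (K v) \<le> \<kappa> * norm v"
        by (rule order_trans[OF onorm[OF K(1)] mult_right_mono[OF small[folded K_def] norm_ge_zero]])
      then have "sqrt M * norm (K v) \<le> sqrt M * (\<kappa> * norm v)"
        using M(1) by (intro mult_left_mono) auto
      then have "?N (K v) \<le> sqrt M * (\<kappa> * norm v)"
        by (rule order_trans[OF upper])
      also have "\<dots> = c / 6 * (sqrt M * \<theta> * norm v)" by (simp add: \<kappa>_def)
      also have "\<dots> \<le> c / 6 * ?N v"
        unfolding \<theta>(2) using c(1) by (intro mult_left_mono lower) auto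
      finally show ?thesis .
    qed
    obtain r s where rs: "\<And>n. n \<ge> 1 \<Longrightarrow> is_arg_min
          (\<lambda>(r', s'). 1/2 * bs (U (n - 1) + T r' s') (U (n - 1) + T r' s')
                      - l (T r' s') + b (U (n - 1)) (T r' s')) (\<lambda>_. True) (r n, s n)"
        "\<And>n. n \<ge> 1 \<Longrightarrow> U n = U (n - 1) + T (r n) (s n)"
      using U unfolding decomposition_sequence_def by blast
    have step: "bs (u - U (Suc n)) (u - U (Suc n)) \<le> (1 - c\<^sup>2 / 4) * bs (u - U n) (u - U n)" for n
    proof -
      define e where "e = u - U n"
      define z where "z = T (r (Suc n)) (s (Suc n))"
      \<comment> \<open>By the equation for \<open>u\<close>, the linear part of the objective is \<open>bs (e + K e)\<close>.\<close>
      have objective: "1/2 * bs (U n + \<sigma>) (U n + \<sigma>) - l \<sigma> + b (U n) \<sigma> =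
          1/2 * bs (U n) (U n) + (1/2 * bs \<sigma> \<sigma> - bs (e + K e) \<sigma>)" for \<sigma>
      proof -
        have "bs (e + K e) \<sigma> = l \<sigma> - bs (U n) \<sigma> - b (U n) \<sigma>"
          using u[rule_format, of \<sigma>] by (simp add: bs.add_left K(2) e_def bs.diff_left b.diff_left)
        then show ?thesis
          using bs(2)[unfolded symmetric_form_def, rule_format, of \<sigma> "U n"]
          by (simp add: bs.add_left bs.add_right)
      qed
      have minimal: "1/2 * bs z z - bs (e + K e) z \<le> 1/2 * bs \<sigma> \<sigma> - bs (e + K e) \<sigma>" if mem: "\<sigma> \<in> ?S" for \<sigma>
      proof -
        obtain r' s' where \<sigma>: "\<sigma> = T r' s'" using mem by blast
        have "\<not> (1/2 * bs (U n + \<sigma>) (U n + \<sigma>) - l \<sigma> + b (U n) \<sigma>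
            < 1/2 * bs (U n + z) (U n + z) - l z + b (U n) z)"
          using rs(1)[of "Suc n"] unfolding is_arg_min_def \<sigma> z_def by auto
        then show ?thesis unfolding objective by linarith
      qed
      have "z \<in> ?S" unfolding z_def by blast
      have "bs (e - z) (e - z) \<le> (1 - c\<^sup>2 / 4) * bs e e"
      proof (rule greedy_step_contraction[of bs c ?S "K e" e z])
        show "sqrt (bs (K e) (K e)) \<le> c / 6 * sqrt (bs e e)" by (rule K_small)
        show "t *\<^sub>R \<sigma> \<in> ?S" if "\<sigma> \<in> ?S" for t \<sigma> by (rule cone[OF that])
        show "c * \<bar>f v\<bar> \<le> d * sqrt (bs v v)"
          if "linear f" "0 \<le> d" "\<And>\<sigma>. \<sigma> \<in> ?S \<Longrightarrow> \<bar>f \<sigma>\<bar> \<le> d * sqrt (bs \<sigma> \<sigma>)" for f d v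
          by (rule dual[OF that])
      qed (fact bs(1) bs(2) pos c(1) c(2) minimal \<open>z \<in> ?S\<close>)+
      moreover have "u - U (Suc n) = e - z"
        using rs(2)[of "Suc n"] by (simp add: e_def z_def)
      ultimately show ?thesis by (simp only: e_def)
    qed
    have "c\<^sup>2 \<le> 1" "0 < c\<^sup>2" using c(1,2) by (auto simp: power_le_one)
    then show ?thesis
      by (intro geometric_decay_imp_convergence[where q = "\<lambda>v. bs v v" and \<rho> = "1 - c\<^sup>2 / 4", OF \<alpha>(1)])
        (use \<alpha>(2) step in auto)
  qed
  ultimately show ?thesis by blast
qed

theorem proposition5p1:
  fixes X :: "'x::euclidean_space set" and T :: "'t::euclidean_space set"
    and \<mu>x :: "'x measure" and \<mu>t :: "'t measure"
    and \<iota>x :: "'r::{real_inner, complete_space} \<Rightarrow> 'x \<Rightarrow> real"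
    and \<iota>t :: "'s::{real_inner, complete_space} \<Rightarrow> 't \<Rightarrow> real"
    and \<iota> :: "'v::{real_inner, complete_space} \<Rightarrow> 'x \<times> 't \<Rightarrow> real"
    and tens :: "'r \<Rightarrow> 's \<Rightarrow> 'v" and \<Sigma> :: "'v set"
    and bs :: "'v \<Rightarrow> 'v \<Rightarrow> real"
  defines "tens \<equiv> tensor \<mu>x \<mu>t \<iota>x \<iota>t \<iota>"
  defines "\<Sigma> \<equiv> {tens r s | r s. True}"
  assumes "open X" and "open T"
    and "space \<mu>x = X" and "sets (restrict_space borel X) \<subseteq> sets \<mu>x"
    and "space \<mu>t = T" and "sets (restrict_space borel T) \<subseteq> sets \<mu>t"
    and "L2_subspace \<mu>x \<iota>x" and "L2_subspace \<mu>t \<iota>t" and "L2_subspace (\<mu>x \<Otimes>\<^sub>M \<mu>t) \<iota>"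
    and Sigma_subset: "\<forall>r s. \<exists>v. represents_tensor \<mu>x \<mu>t \<iota>x \<iota>t \<iota> r s v"
    and A1: "closure (span \<Sigma>) = UNIV"
    and A2: "closedin weak_topology \<Sigma>"
    and finite_dim_x: "\<exists>B :: 'r set. finite B \<and> span B = UNIV"
    and finite_dim_t: "\<exists>B :: 's set. finite B \<and> span B = UNIV"
    and bs: "bounded_bilinear bs" "symmetric_form bs" "coercive_form bs"
  shows "\<exists>\<kappa>>0. \<forall>b l u.
           bounded_bilinear b \<longrightarrow>
           uniquely_solvable (\<lambda>w v. bs w v + b w v) \<longrightarrow>
           bounded_linear l \<longrightarrow>
           (\<forall>v. bs u v + b u v = l v) \<longrightarrow>
           onorm (inv (form_operator bs) \<circ> form_operator b) \<le> \<kappa> \<longrightarrow>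
           (\<forall>U. decomposition_sequence tens bs b l U \<longrightarrow> U \<longlonglongrightarrow> u)"
proof -
  have T: "bilinear tens"
    unfolding tens_def by (rule bilinear_tensor) fact+
  obtain B :: "'r set" and C :: "'s set" where B: "finite B" "span B = UNIV"
    and C: "finite C" "span C = UNIV"
    using finite_dim_x finite_dim_t by blast
  define D where "D = {tens b c | b c. b \<in> B \<and> c \<in> C}"
  have "D = (\<lambda>(b, c). tens b c) ` (B \<times> C)" by (auto simp: D_def)
  then have "finite D" using B C by simp
  have "span \<Sigma> \<subseteq> span D"
    by (rule span_minimal) (auto simp: \<Sigma>_def D_def intro: bilinear_in_span_image[OF T B(2) C(2)])
  then have "closure (span \<Sigma>) \<subseteq> span D"
    by (rule closure_minimal) (rule closed_span_finite[OF \<open>finite D\<close>])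
  then have D: "span D = UNIV" using A1 by auto
  then have "span \<Sigma> = UNIV"
    using span_mono[of D \<Sigma>] by (auto simp: \<Sigma>_def D_def)
  then have "span {tens r s | r s. True} = UNIV" by (simp add: \<Sigma>_def)
  from small_perturbation_greedy_convergence[OF T \<open>finite D\<close> D this bs]
  show ?thesis by blast
qed

end
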